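(* Let $\mathbb{F}$ be a field and $d\ge 0$ an integer. Let $P$ denote an almost orthogonal (AO) normalized solid invertible matrix in $\mathrm{Mat}_{d+1}(\mathbb{F})$. Let $\{e_i\}_{i=0}^d$ denote indeterminates, and let $\mathcal{C}$ denote the vector space over $\mathbb{F}$ with basis $\{e_i\}_{i=0}^d$. Turn $\mathcal{C}$ into an algebra such that $e_ie_j=\delta_{i,j}e_i$ for $0\le i,j\le d$. View $P$ as the transition matrix from the basis $\{e_i\}_{i=0}^d$ of $\mathcal{C}$ to a basis $\{x_i\}_{i=0}^d$ of $\mathcal{C}$, that is, $x_j=\sum_{i=0}^d P_{i,j}e_i$ for $0\le j\le d$. Then $\Psi_P=(\mathcal{C};\{x_i\}_{i=0}^d;\{e_i\}_{i=0}^d)$ is a character system over $\mathbb{F}$ that has eigenmatrix $P$.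
   Context: All algebras are associative, unital, over $\mathbb{F}$. Matrices in $\mathrm{Mat}_{d+1}(\mathbb{F})$ have rows and columns indexed by $0,1,\ldots,d$. Matrices. An invertible $R\in\mathrm{Mat}_{d+1}(\mathbb{F})$ is solid if for both $R$ and $R^{-1}$ all entries in column $0$ and in row $0$ are nonzero. A solid invertible $R$ is normalized if all entries in column $0$ of $R$ are equal to $1$ and all entries in column $0$ of $R^{-1}$ are the same. $S,T$ are diagonally equivalent if $T=HSK$ for some invertible diagonal matrices $H,K$. $R$ is AO if it is invertible and $R^{\sf t}$ (transpose) is diagonally equivalent to $R^{-1}$. Character systems. A character algebra over $\mathbb{F}$ with diameter $d$ is a sequence $(\mathcal{C};\{x_i\}_{i=0}^d)$ where $\mathcal{C}$ is a commutative $\mathbb{F}$-algebra and $x_i\in\mathcal{C}$ satisfy: (i) $x_0=1$; (ii) $\{x_i\}_{i=0}^d$ is a basis of $\mathcal{C}$; (iii) writing $x_ix_j=\sum_{h=0}^d p^h_{ij}x_h$, there are nonzero scalars $\{k_i\}_{i=0}^d$ with $p^0_{ij}=\delta_{i,j}k_i$ for $0\le i,j\le d$; (iv) there is an algebra homomorphism $\varphi:\mathcal{C}\to\mathbb{F}$ with $\varphi(x_i)=k_i$ for $0\le i\le d$. It is semisimple if $\mathcal{C}$ has a basis $\{e_i\}_{i=0}^d$ with $e_ie_j=\delta_{i,j}e_i$ and $1=\sum_{i=0}^d e_i$; these $e_i$ (unique up to permutation) are the primitive idempotents. Exactly one primitive idempotent is not sent to $0$ by $\varphi$; it is called trivial.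 A character system over $\mathbb{F}$ with diameter $d$ is a sequence $\Psi=(\mathcal{C};\{x_i\}_{i=0}^d;\{e_i\}_{i=0}^d)$ where $(\mathcal{C};\{x_i\}_{i=0}^d)$ is a semisimple character algebra over $\mathbb{F}$ and $\{e_i\}_{i=0}^d$ is an ordering of the primitive idempotents with $e_0$ trivial. The eigenmatrix of $\Psi$ is the transition matrix from $\{e_i\}_{i=0}^d$ to $\{x_i\}_{i=0}^d$. *)

theory Defs
  imports "Jordan_Normal_Form.VS_Connect" "Jordan_Normal_Form.Gauss_Jordan_Elimination"
begin

text \<open>The field is a type \<open>'a :: field\<close>. A matrix in \<open>carrier_mat (d + 1) (d + 1)\<close> has its rows
  and columns indexed by \<open>0, ..., d\<close>.\<close>

text \<open>\<^const>\<open>mat_inverse\<close> returns an option; on an invertible matrix it is \<^const>\<open>Some\<close> of the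
  two-sided inverse, so \<open>mat_inv\<close> is only meaningful there.\<close>

abbreviation mat_inv :: "'a::field mat \<Rightarrow> 'a mat" where
  "mat_inv R \<equiv> the (mat_inverse R)"

definition solid :: "nat \<Rightarrow> 'a::field mat \<Rightarrow> bool" where
  "solid d R \<longleftrightarrow> R \<in> carrier_mat (d + 1) (d + 1) \<and> invertible_mat R \<and>
     (\<forall>i\<le>d. R $$ (i, 0) \<noteq> 0 \<and> R $$ (0, i) \<noteq> 0 \<and>
            mat_inv R $$ (i, 0) \<noteq> 0 \<and> mat_inv R $$ (0, i) \<noteq> 0)"

definition normalized :: "nat \<Rightarrow> 'a::field mat \<Rightarrow> bool" where
  "normalized d R \<longleftrightarrow> solid d R \<and> (\<forall>i\<le>d. R $$ (i, 0) = 1) \<and>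
     (\<forall>i\<le>d. \<forall>j\<le>d. mat_inv R $$ (i, 0) = mat_inv R $$ (j, 0))"

definition diagonally_equivalent :: "nat \<Rightarrow> 'a::field mat \<Rightarrow> 'a mat \<Rightarrow> bool" where
  "diagonally_equivalent d S T \<longleftrightarrow>
     S \<in> carrier_mat (d + 1) (d + 1) \<and> T \<in> carrier_mat (d + 1) (d + 1) \<and>
     (\<exists>H K. H \<in> carrier_mat (d + 1) (d + 1) \<and> K \<in> carrier_mat (d + 1) (d + 1) \<and>
            diagonal_mat H \<and> invertible_mat H \<and> diagonal_mat K \<and> invertible_mat K \<and>
            T = H * S * K)"

definition almost_orthogonal :: "nat \<Rightarrow> 'a::field mat \<Rightarrow> bool" where
  "almost_orthogonal d R \<longleftrightarrow> R \<in> carrier_mat (d + 1) (d + 1) \<and> invertible_mat R \<and>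
     diagonally_equivalent d (transpose_mat R) (mat_inv R)"

text \<open>A commutative algebra over the field \<open>'a\<close> is a record \<open>C\<close> with \<open>algebra class_ring C\<close>,
  where \<open>class_ring\<close> is the type \<open>'a\<close> viewed as a ring record; the library locale
  \<^locale>\<open>algebra\<close> includes commutativity of the multiplication. Finite sequences indexed by
  \<open>0, ..., d\<close> are functions on \<^typ>\<open>nat\<close> whose values beyond \<open>d\<close> are irrelevant.\<close>

text \<open>\<open>vectorspace.basis\<close> speaks about sets, hence the injectivity condition.\<close>

definition basis_family :: "nat \<Rightarrow> ('a::field, 'c) module \<Rightarrow> (nat \<Rightarrow> 'c) \<Rightarrow> bool" where
  "basis_family d C x \<longleftrightarrow> inj_on x {..d} \<and> vectorspace.basis class_ring C (x ` {..d})"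

definition algebra_hom_to_field :: "('a::field, 'c) module \<Rightarrow> ('c \<Rightarrow> 'a) \<Rightarrow> bool" where
  "algebra_hom_to_field C \<phi> \<longleftrightarrow> \<phi> \<in> Ring.ring_hom C class_ring \<and>
     (\<forall>a. \<forall>u\<in>carrier C. \<phi> (a \<odot>\<^bsub>C\<^esub> u) = a * \<phi> u)"

text \<open>\<open>p i j h\<close> is the scalar usually written with lower indices \<open>i, j\<close> and upper index \<open>h\<close>.\<close>

definition intersection_numbers ::
  "nat \<Rightarrow> ('a::field, 'c) module \<Rightarrow> (nat \<Rightarrow> 'c) \<Rightarrow> (nat \<Rightarrow> nat \<Rightarrow> nat \<Rightarrow> 'a) \<Rightarrow> bool" where
  "intersection_numbers d C x p \<longleftrightarrow>
     (\<forall>i\<le>d. \<forall>j\<le>d. x i \<otimes>\<^bsub>C\<^esub> x j = finsum C (\<lambda>h. p i j h \<odot>\<^bsub>C\<^esub> x h) {..d})"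

definition valencies ::
  "nat \<Rightarrow> ('a::field, 'c) module \<Rightarrow> (nat \<Rightarrow> 'c) \<Rightarrow> (nat \<Rightarrow> 'a) \<Rightarrow> bool" where
  "valencies d C x k \<longleftrightarrow> (\<forall>i\<le>d. k i \<noteq> 0) \<and>
     (\<exists>p. intersection_numbers d C x p \<and>
          (\<forall>i\<le>d. \<forall>j\<le>d. p i j 0 = (if i = j then k i else 0)))"

text \<open>In a character algebra the scalars \<open>k i\<close> (for \<open>i \<le> d\<close>) and the homomorphism \<open>\<phi>\<close> (on the
  carrier) are determined by \<open>C\<close> and \<open>x\<close>.\<close>

definition character_hom ::
  "nat \<Rightarrow> ('a::field, 'c) module \<Rightarrow> (nat \<Rightarrow> 'c) \<Rightarrow> ('c \<Rightarrow> 'a) \<Rightarrow> bool" where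
  "character_hom d C x \<phi> \<longleftrightarrow> algebra_hom_to_field C \<phi> \<and>
     (\<exists>k. valencies d C x k \<and> (\<forall>i\<le>d. \<phi> (x i) = k i))"

definition character_algebra :: "nat \<Rightarrow> ('a::field, 'c) module \<Rightarrow> (nat \<Rightarrow> 'c) \<Rightarrow> bool" where
  "character_algebra d C x \<longleftrightarrow> algebra class_ring C \<and> x 0 = \<one>\<^bsub>C\<^esub> \<and> basis_family d C x \<and>
     (\<exists>\<phi>. character_hom d C x \<phi>)"

text \<open>The primitive idempotents are unique up to permutation, so this holds for \<open>e\<close> exactly when it
  is an ordering of them.\<close>

definition primitive_idempotents :: "nat \<Rightarrow> ('a::field, 'c) module \<Rightarrow> (nat \<Rightarrow> 'c) \<Rightarrow> bool" where
  "primitive_idempotents d C e \<longleftrightarrow> basis_family d C e \<and>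
     (\<forall>i\<le>d. \<forall>j\<le>d. e i \<otimes>\<^bsub>C\<^esub> e j = (if i = j then e i else \<zero>\<^bsub>C\<^esub>)) \<and>
     \<one>\<^bsub>C\<^esub> = finsum C e {..d}"

definition semisimple :: "nat \<Rightarrow> ('a::field, 'c) module \<Rightarrow> bool" where
  "semisimple d C \<longleftrightarrow> (\<exists>e. primitive_idempotents d C e)"

definition trivial_idempotent ::
  "nat \<Rightarrow> ('a::field, 'c) module \<Rightarrow> (nat \<Rightarrow> 'c) \<Rightarrow> 'c \<Rightarrow> bool" where
  "trivial_idempotent d C x f \<longleftrightarrow> (\<exists>\<phi>. character_hom d C x \<phi> \<and> \<phi> f \<noteq> 0)"

type_synonym ('a, 'c) algebra_system = "('a, 'c) module \<times> (nat \<Rightarrow> 'c) \<times> (nat \<Rightarrow> 'c)"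

definition character_system :: "nat \<Rightarrow> ('a::field, 'c) algebra_system \<Rightarrow> bool" where
  "character_system d \<Psi> \<longleftrightarrow> (case \<Psi> of (C, x, e) \<Rightarrow>
     character_algebra d C x \<and> semisimple d C \<and> primitive_idempotents d C e \<and>
     trivial_idempotent d C x (e 0))"

definition transition_matrix ::
  "nat \<Rightarrow> ('a::field, 'c) module \<Rightarrow> (nat \<Rightarrow> 'c) \<Rightarrow> (nat \<Rightarrow> 'c) \<Rightarrow> 'a mat" where
  "transition_matrix d C u v = (THE M. M \<in> carrier_mat (d + 1) (d + 1) \<and>
     (\<forall>j\<le>d. v j = finsum C (\<lambda>i. M $$ (i, j) \<odot>\<^bsub>C\<^esub> u i) {..d}))"

definition eigenmatrix :: "nat \<Rightarrow> ('a::field, 'c) algebra_system \<Rightarrow> 'a mat" where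
  "eigenmatrix d \<Psi> = (case \<Psi> of (C, x, e) \<Rightarrow> transition_matrix d C e x)"

text \<open>The vector space with basis the indeterminates \<open>e\<^sub>0, ..., e\<^sub>d\<close> is realised as the coordinate
  space, \<open>e\<^sub>i\<close> being the \<open>i\<close>-th unit vector. The product is the bilinear extension of
  \<open>e\<^sub>i e\<^sub>j = \<delta>\<^sub>i\<^sub>j e\<^sub>i\<close>; \<^const>\<open>module_vec\<close> leaves \<open>mult\<close> and \<open>one\<close> unspecified.\<close>

definition idem_vec :: "nat \<Rightarrow> nat \<Rightarrow> 'a::field vec" where
  "idem_vec d i = unit_vec (d + 1) i"

definition idem_algebra :: "'a::field itself \<Rightarrow> nat \<Rightarrow> ('a, 'a vec) module" where
  "idem_algebra ty d = (let V = module_vec TYPE('a) (d + 1) in V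
     \<lparr> mult := \<lambda>u v. finsum V (\<lambda>(i, j). (u $ i * v $ j) \<odot>\<^bsub>V\<^esub>
                 (if i = j then idem_vec d i else \<zero>\<^bsub>V\<^esub>)) ({..d} \<times> {..d}),
       one := finsum V (idem_vec d) {..d} \<rparr>)"

lemma idem_algebra_mult:
  fixes d :: nat
  assumes "i \<le> d" "j \<le> d"
  shows "idem_vec d i \<otimes>\<^bsub>idem_algebra TYPE('a::field) d\<^esub> idem_vec d j =
           (if i = j then idem_vec d i else \<zero>\<^bsub>idem_algebra TYPE('a) d\<^esub>)"
proof -
  define V where "V = module_vec TYPE('a) (d + 1)"
  define g :: "nat \<times> nat \<Rightarrow> 'a vec" where
    "g = (\<lambda>(i, j). if i = j then idem_vec d i else \<zero>\<^bsub>V\<^esub>)"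
  have "vectorspace (class_ring :: 'a ring) V"
    unfolding V_def by (rule vec_vs)
  then interpret V: abelian_monoid V
    by (intro abelian_group.axioms(1) Module.module.axioms(2) vectorspace.axioms(1))
  have g: "g p \<in> carrier V" for p
    by (cases p) (auto simp: g_def idem_vec_def V_def module_vec_simps)
  have "idem_vec d i \<otimes>\<^bsub>idem_algebra TYPE('a) d\<^esub> idem_vec d j =
      finsum V (\<lambda>(k, l). (idem_vec d i $ k * idem_vec d j $ l) \<odot>\<^bsub>V\<^esub> g (k, l)) ({..d} \<times> {..d})"
    unfolding idem_algebra_def Let_def g_def V_def by simp
  also have "\<dots> = finsum V (\<lambda>p. if (i, j) = p then g p else \<zero>\<^bsub>V\<^esub>) ({..d} \<times> {..d})"
  proof (rule V.finsum_cong'[OF refl])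
    show "(\<lambda>p. if (i, j) = p then g p else \<zero>\<^bsub>V\<^esub>) \<in>
        {..d} \<times> {..d} \<rightarrow> carrier V"
      using g by auto
    fix p assume "p \<in> {..d} \<times> {..d}"
    then obtain k l where p: "p = (k, l)" "k \<le> d" "l \<le> d" by auto
    have "g (k, l) \<in> carrier_vec (d + 1)" using g[of "(k, l)"] by (simp add: V_def module_vec_simps)
    then show "(case p of (k, l) \<Rightarrow> (idem_vec d i $ k * idem_vec d j $ l) \<odot>\<^bsub>V\<^esub> g (k, l)) =
        (if (i, j) = p then g p else \<zero>\<^bsub>V\<^esub>)"
      using p assms by (auto simp: V_def idem_vec_def module_vec_simps)
  qed
  also have "\<dots> = g (i, j)"
    by (rule V.finsum_singleton) (use assms g in auto)
  finally show ?thesis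
    by (simp add: g_def V_def idem_algebra_def Let_def)
qed

definition Psi_of :: "nat \<Rightarrow> 'a::field mat \<Rightarrow> ('a, 'a vec) algebra_system" where
  "Psi_of d P = (let C = idem_algebra TYPE('a) d in
     (C, \<lambda>j. finsum C (\<lambda>i. P $$ (i, j) \<odot>\<^bsub>C\<^esub> idem_vec d i) {..d}, idem_vec d))"

end

theory Submission
  imports Defs
begin

text \<open>Multiplication in the algebra is entrywise on coordinate vectors, so every coordinate is an
  algebra homomorphism, and \<open>\<phi>\<close> is coordinate \<open>0\<close>. Write \<open>P\<inverse> = H P\<^sup>T K\<close> with diagonal \<open>H\<close> and
  \<open>K\<close>. Since column \<open>0\<close> of \<open>P\<close> consists of ones, \<open>(P\<inverse>)\<^sub>0\<^sub>r = h\<^sub>0 k\<^sub>r\<close>, whence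
  \<open>p\<^sup>0\<^sub>i\<^sub>j = \<Sum>r. (P\<inverse>)\<^sub>0\<^sub>r P\<^sub>r\<^sub>i P\<^sub>r\<^sub>j = (h\<^sub>0 / h\<^sub>i) (P\<inverse> P)\<^sub>i\<^sub>j = \<delta>\<^sub>i\<^sub>j h\<^sub>0 / h\<^sub>i\<close>.
  As column \<open>0\<close> of \<open>P\<inverse>\<close> is constant, \<open>h\<^sub>i P\<^sub>0\<^sub>i k\<^sub>0 = h\<^sub>0 k\<^sub>0\<close>, so that
  \<open>h\<^sub>0 / h\<^sub>i = P\<^sub>0\<^sub>i\<close> is the coordinate \<open>0\<close> of \<open>x\<^sub>i\<close>.\<close>

section \<open>Inverses, diagonal scaling and bases indexed by families\<close>

text \<open>\<open>mat_inverse\<close> yields \<open>None\<close> only for matrices that are not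
  units of \<open>ring_mat\<close>, so exhibiting a two-sided inverse leaves the \<open>Some\<close>
  case, whose value is the inverse.\<close>

lemma mat_inv_inverse:
  fixes A :: "'a::field mat"
  assumes A: "A \<in> carrier_mat n n" and inv: "invertible_mat A"
  shows "mat_inv A \<in> carrier_mat n n" "A * mat_inv A = 1\<^sub>m n" "mat_inv A * A = 1\<^sub>m n"
proof -
  obtain B where "A * B = 1\<^sub>m n" "B * A = 1\<^sub>m (dim_row B)"
    using A inv unfolding invertible_mat_def inverts_mat_def by auto
  \<comment> \<open>The dimensions of \<open>B\<close> are forced: comparing column counts in
    \<open>A * B = 1\<^sub>m n\<close> gives \<open>dim_col B = n\<close>, and in the other product
    \<open>dim_row B = n\<close>.\<close>
  moreover from this have "B \<in> carrier_mat n n"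
    using A by (metis carrier_matD(2) carrier_matI index_mult_mat(3) index_one_mat(3))
  ultimately have "A \<in> Units (ring_mat TYPE('a) n ())"
    using A by (auto simp: Units_def ring_mat_simps)
  then obtain C where C: "mat_inverse A = Some C"
    using mat_inverse(1)[OF A, where b = "()"] by (cases "mat_inverse A") auto
  show "mat_inv A \<in> carrier_mat n n" "A * mat_inv A = 1\<^sub>m n" "mat_inv A * A = 1\<^sub>m n"
    using mat_inverse(2)[OF A C] C by auto
qed

lemma mult_mat_vec_cancel:
  fixes A B :: "'a::semiring_1 mat"
  assumes "A \<in> carrier_mat n n" "B \<in> carrier_mat n n" "A * B = 1\<^sub>m n" "v \<in> carrier_vec n"
  shows "A *\<^sub>v (B *\<^sub>v v) = v"
  using assoc_mult_mat_vec[OF assms(1,2,4)] assms by simp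

lemma index_mat_mult_diagonal:
  fixes A :: "'a::semiring_0 mat"
  assumes "H \<in> carrier_mat n n" "A \<in> carrier_mat n n" "K \<in> carrier_mat n n"
    and "diagonal_mat H" "diagonal_mat K" "i < n" "j < n"
  shows "(H * A * K) $$ (i, j) = H $$ (i, i) * A $$ (i, j) * K $$ (j, j)"
proof -
  have "(H * A) $$ (i, l) = H $$ (i, i) * A $$ (i, l)" if "l < n" for l
  proof -
    have "(H * A) $$ (i, l) = (\<Sum>m<n. H $$ (i, m) * A $$ (m, l))"
      using assms that by (simp add: scalar_prod_def lessThan_atLeast0)
    also have "\<dots> = (\<Sum>m<n. if m = i then H $$ (i, i) * A $$ (i, l) else 0)"
      using assms that by (intro sum.cong) (auto simp: diagonal_mat_def)
    finally show ?thesis using assms by simp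
  qed
  moreover have "(H * A * K) $$ (i, j) = (\<Sum>m<n. (H * A) $$ (i, m) * K $$ (m, j))"
    using assms by (simp add: scalar_prod_def lessThan_atLeast0 del: assoc_mult_mat)
  moreover have "\<dots> = (\<Sum>m<n. if m = j then (H * A) $$ (i, j) * K $$ (j, j) else 0)"
    using assms by (intro sum.cong) (auto simp: diagonal_mat_def)
  ultimately show ?thesis using assms by simp
qed

text \<open>\<open>lincomb\<close> attaches coefficients to vectors, whereas the families here carry
  them on indices. Injectivity of \<open>x\<close> lets one translate between the two, so both basis
  conditions can be checked on indexed sums.\<close>

lemma basis_familyI:
  fixes C :: "('a::field, 'c) module"
  assumes C: "vectorspace class_ring C"
    and x: "x \<in> {..d} \<rightarrow> carrier C" and inj: "inj_on x {..d}"
    and gen: "\<And>v. v \<in> carrier C \<Longrightarrow> \<exists>a. v = finsum C (\<lambda>j. a j \<odot>\<^bsub>C\<^esub> x j) {..d}"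
    and indep: "\<And>a j. finsum C (\<lambda>j. a j \<odot>\<^bsub>C\<^esub> x j) {..d} = \<zero>\<^bsub>C\<^esub> \<Longrightarrow> j \<le> d \<Longrightarrow> a j = 0"
  shows "basis_family d C x"
proof -
  interpret vectorspace class_ring C by (rule C)
  let ?S = "x ` {..d}"
  have S: "?S \<subseteq> carrier C" using x by auto
  have lincomb: "lincomb a ?S = finsum C (\<lambda>j. a (x j) \<odot>\<^bsub>C\<^esub> x j) {..d}" for a
    unfolding lincomb_def by (rule M.finsum_reindex) (use x inj in \<open>auto simp: class_ring_simps\<close>)
  have "lin_indpt ?S"
  proof (rule finite_lin_indpt2)
    fix a assume "lincomb a ?S = \<zero>\<^bsub>C\<^esub>"
    then have "a (x j) = 0" if "j \<le> d" for j
      using indep[of "\<lambda>j. a (x j)", OF _ that] unfolding lincomb by blast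
    then show "\<forall>v\<in>?S. a v = \<zero>\<^bsub>class_ring\<^esub>" by simp
  qed (simp_all add: S)
  moreover have "v \<in> span ?S" if v: "v \<in> carrier C" for v
  proof -
    obtain a where a: "v = finsum C (\<lambda>j. a j \<odot>\<^bsub>C\<^esub> x j) {..d}" using gen[OF v] by auto
    \<comment> \<open>The coefficient of a vector in the image is that of its unique index.\<close>
    have "v = lincomb (a \<circ> inv_into {..d} x) ?S"
      unfolding lincomb a
      by (rule M.finsum_cong') (use x inj in \<open>auto simp: inv_into_f_f class_ring_simps\<close>)
    then show ?thesis by (auto simp: span_def)
  qed
  then have "gen_set ?S" using span_is_subset2[OF S] by auto
  ultimately show ?thesis using S inj by (simp add: basis_family_def basis_def)
qed

section \<open>Linear structure of the algebra of idempotents\<close>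

lemma idem_algebra_simps:
  "carrier (idem_algebra TYPE('a::field) d) = carrier_vec (d + 1)"
  "add (idem_algebra TYPE('a) d) = (+)"
  "zero (idem_algebra TYPE('a) d) = 0\<^sub>v (d + 1)"
  "module.smult (idem_algebra TYPE('a) d) = (\<cdot>\<^sub>v)"
  by (simp_all add: idem_algebra_def module_vec_simps Let_def)

lemma idem_algebra_vectorspace:
  "vectorspace class_ring (idem_algebra TYPE('a::field) d)"
proof -
  let ?C = "idem_algebra TYPE('a) d"
  have "abelian_group ?C"
    by (rule abelian_groupI)
      (auto simp: idem_algebra_simps add.assoc intro: comm_add_vec intro!: bexI[of _ "- _"])
  then have "module class_ring ?C"
    by (intro moduleI class_cring.is_cring)
      (auto simp: idem_algebra_simps class_ring_simps add_smult_distrib_vec smult_add_distrib_vec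
        smult_smult_assoc)
  then show ?thesis by (intro vectorspace.intro class_field)
qed

lemma index_finsum_idem_algebra:
  assumes f: "f \<in> A \<rightarrow> carrier_vec (d + 1)" and i: "i \<le> d"
  shows "finsum (idem_algebra TYPE('a::field) d) f A $ i = (\<Sum>x\<in>A. f x $ i)"
proof -
  interpret vectorspace class_ring "idem_algebra TYPE('a) d" by (rule idem_algebra_vectorspace)
  show ?thesis using f
  proof (induct A rule: infinite_finite_induct)
    case (insert x A)
    have "finsum (idem_algebra TYPE('a) d) f A \<in> carrier_vec (d + 1)"
      using insert M.finsum_closed[of f A] by (simp add: idem_algebra_simps)
    then show ?case using insert i by (simp add: idem_algebra_simps)
  \<comment> \<open>For empty or infinite \<open>A\<close> both sums are zero, the infinite case by
    the default values.\<close>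
  qed (use i in \<open>auto simp: idem_algebra_simps\<close>)
qed

text \<open>\<open>finsum\<close> sees only the additive part of the record, which the updates of
  \<open>mult\<close> and \<open>one\<close> leave alone. This links the sums over
  \<open>module_vec\<close> in the definition of the algebra to sums in the algebra itself.\<close>

lemma finsum_idem_algebra_eq:
  "finsum (idem_algebra TYPE('a::field) d) = finsum (module_vec TYPE('a) (d + 1))"
  by (intro ext) (simp add: finsum_def idem_algebra_def Let_def)

lemma finsum_idem_algebra_closed:
  "f \<in> A \<rightarrow> carrier_vec (d + 1) \<Longrightarrow> finsum (idem_algebra TYPE('a::field) d) f A \<in> carrier_vec (d + 1)"
proof -
  interpret vectorspace class_ring "idem_algebra TYPE('a) d" by (rule idem_algebra_vectorspace)
  show "f \<in> A \<rightarrow> carrier_vec (d + 1) \<Longrightarrow> ?thesis"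
    using M.finsum_closed[of f A] by (simp add: idem_algebra_simps)
qed

text \<open>Turns questions about linear combinations of the \<open>x j\<close> into matrix
  identities.\<close>

lemma finsum_smult_cols:
  fixes P :: "'a::field mat"
  assumes P: "P \<in> carrier_mat (d + 1) (d + 1)" and x: "\<And>j. j \<le> d \<Longrightarrow> x j = col P j"
  shows "finsum (idem_algebra TYPE('a) d) (\<lambda>j. a j \<odot>\<^bsub>idem_algebra TYPE('a) d\<^esub> x j) {..d} =
    P *\<^sub>v vec (d + 1) a" (is "?l = _")
proof
  have x': "(\<lambda>j. a j \<cdot>\<^sub>v x j) \<in> {..d} \<rightarrow> carrier_vec (d + 1)"
    using x by (auto simp: carrier_matD[OF P] intro!: carrier_vecI)
  show "dim_vec ?l = dim_vec (P *\<^sub>v vec (d + 1) a)"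
    using finsum_idem_algebra_closed[OF x'] P by (simp add: idem_algebra_simps)
  fix i assume "i < dim_vec (P *\<^sub>v vec (d + 1) a)"
  then have i: "i \<le> d" using P by simp
  have "?l $ i = (\<Sum>j\<le>d. (a j \<cdot>\<^sub>v x j) $ i)"
    using index_finsum_idem_algebra[OF x' i] by (simp add: idem_algebra_simps)
  also have "\<dots> = (\<Sum>j\<le>d. P $$ (i, j) * a j)"
    using P x i by (intro sum.cong) auto
  also have "\<dots> = (P *\<^sub>v vec (d + 1) a) $ i"
    using P i by (simp add: scalar_prod_def atLeast0LessThan lessThan_Suc_atMost del: sum.atMost_Suc)
  finally show "?l $ i = (P *\<^sub>v vec (d + 1) a) $ i" .
qed

text \<open>The coordinates of \<open>v\<close> are the entries of \<open>Q *\<^sub>v v\<close>: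
  \<open>P * Q = 1\<close> gives spanning, and \<open>Q * P = 1\<close> gives independence.
  Injectivity holds because \<open>Q\<close> maps column \<open>j\<close> of \<open>P\<close> to the
  \<open>j\<close>-th unit vector.\<close>

lemma basis_family_cols:
  fixes P Q :: "'a::field mat"
  assumes P: "P \<in> carrier_mat (d + 1) (d + 1)" and Q: "Q \<in> carrier_mat (d + 1) (d + 1)"
    and PQ: "P * Q = 1\<^sub>m (d + 1)" and QP: "Q * P = 1\<^sub>m (d + 1)"
    and x: "\<And>j. j \<le> d \<Longrightarrow> x j = col P j"
  shows "basis_family d (idem_algebra TYPE('a) d) x"
proof (rule basis_familyI[OF idem_algebra_vectorspace])
  show "x \<in> {..d} \<rightarrow> carrier (idem_algebra TYPE('a) d)"
    using x by (auto simp: idem_algebra_simps carrier_matD[OF P] intro!: carrier_vecI)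
  show "inj_on x {..d}"
  proof
    fix i j assume ij: "i \<in> {..d}" "j \<in> {..d}" "x i = x j"
    then have "col (Q * P) i = col (Q * P) j" using P Q x by (simp add: col_mult2)
    then have "unit_vec (d + 1) i = (unit_vec (d + 1) j :: 'a vec)" using QP ij by simp
    then have "unit_vec (d + 1) i $ i = (unit_vec (d + 1) j $ i :: 'a)" by simp
    then show "i = j" using ij by (simp split: if_splits)
  qed
  show "\<exists>a. v = finsum (idem_algebra TYPE('a) d) (\<lambda>j. a j \<odot>\<^bsub>idem_algebra TYPE('a) d\<^esub> x j) {..d}"
    if "v \<in> carrier (idem_algebra TYPE('a) d)" for v
  proof (intro exI)
    have v: "v \<in> carrier_vec (d + 1)" using that by (simp add: idem_algebra_simps)
    have "vec (d + 1) (\<lambda>j. (Q *\<^sub>v v) $ j) = Q *\<^sub>v v" using Q by (intro eq_vecI) auto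
    moreover have "P *\<^sub>v (Q *\<^sub>v v) = v" by (rule mult_mat_vec_cancel[OF P Q PQ v])
    ultimately show "v = finsum (idem_algebra TYPE('a) d)
        (\<lambda>j. (Q *\<^sub>v v) $ j \<odot>\<^bsub>idem_algebra TYPE('a) d\<^esub> x j) {..d}"
      using finsum_smult_cols[OF P x, of "\<lambda>j. (Q *\<^sub>v v) $ j"] by simp
  qed
  show "a j = 0" if "finsum (idem_algebra TYPE('a) d) (\<lambda>j. a j \<odot>\<^bsub>idem_algebra TYPE('a) d\<^esub> x j) {..d} =
      \<zero>\<^bsub>idem_algebra TYPE('a) d\<^esub>" and j: "j \<le> d" for a j
  proof -
    have "P *\<^sub>v vec (d + 1) a = 0\<^sub>v (d + 1)"
      using that finsum_smult_cols[OF P x, of a] by (simp add: idem_algebra_simps)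
    then have "vec (d + 1) a = Q *\<^sub>v 0\<^sub>v (d + 1)"
      using mult_mat_vec_cancel[OF Q P QP, of "vec (d + 1) a"] by simp
    moreover have "(Q *\<^sub>v 0\<^sub>v (d + 1)) $ j = 0"
      using Q j by (simp add: scalar_prod_def)
    moreover have "vec (d + 1) a $ j = a j" using j by simp
    ultimately show ?thesis by metis
  qed
qed

text \<open>Makes the results on columns of a matrix available for the idempotents, with the
  identity as matrix.\<close>

lemma col_one_idem_vec: "j \<le> d \<Longrightarrow> idem_vec d j = col (1\<^sub>m (d + 1)) j"
  by (simp add: idem_vec_def)

lemma finsum_smult_idem_vec:
  "finsum (idem_algebra TYPE('a::field) d) (\<lambda>i. a i \<odot>\<^bsub>idem_algebra TYPE('a) d\<^esub> idem_vec d i) {..d} =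
    vec (d + 1) a"
  by (subst finsum_smult_cols[of "1\<^sub>m (d + 1)"]) (simp_all add: col_one_idem_vec)

section \<open>Multiplication, idempotents and the transition matrix\<close>

text \<open>In the defining double sum only the pair \<open>(l, l)\<close> contributes to coordinate
  \<open>l\<close>. The ring axioms thereby reduce to those of the field, entry by entry.\<close>

lemma idem_algebra_mult_eq:
  fixes u v :: "'a::field vec"
  shows "u \<otimes>\<^bsub>idem_algebra TYPE('a) d\<^esub> v = vec (d + 1) (\<lambda>i. u $ i * v $ i)"
proof -
  let ?f = "\<lambda>(i, j). (u $ i * v $ j) \<cdot>\<^sub>v (if i = j then idem_vec d i else 0\<^sub>v (d + 1))"
  have f: "?f \<in> {..d} \<times> {..d} \<rightarrow> carrier_vec (d + 1)" by (auto simp: idem_vec_def)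
  have eq: "u \<otimes>\<^bsub>idem_algebra TYPE('a) d\<^esub> v =
      finsum (idem_algebra TYPE('a) d) ?f ({..d} \<times> {..d})"
    unfolding finsum_idem_algebra_eq by (simp add: idem_algebra_def Let_def module_vec_simps cong: if_cong)
  show ?thesis unfolding eq
  proof
    show "dim_vec (finsum (idem_algebra TYPE('a) d) ?f ({..d} \<times> {..d})) =
        dim_vec (vec (d + 1) (\<lambda>i. u $ i * v $ i))"
      using finsum_idem_algebra_closed[OF f] by simp
    fix l assume "l < dim_vec (vec (d + 1) (\<lambda>i. u $ i * v $ i))"
    then have l: "l \<le> d" by simp
    have "finsum (idem_algebra TYPE('a) d) ?f ({..d} \<times> {..d}) $ l =
        (\<Sum>p\<in>{..d} \<times> {..d}. ?f p $ l)"
      by (rule index_finsum_idem_algebra[OF f l])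
    also have "\<dots> = (\<Sum>p\<in>{..d} \<times> {..d}. if p = (l, l) then u $ l * v $ l else 0)"
      using l by (intro sum.cong) (auto simp: idem_vec_def split: if_splits)
    finally show "finsum (idem_algebra TYPE('a) d) ?f ({..d} \<times> {..d}) $ l =
        vec (d + 1) (\<lambda>i. u $ i * v $ i) $ l" using l by simp
  qed
qed

lemma idem_algebra_one: "\<one>\<^bsub>idem_algebra TYPE('a::field) d\<^esub> = vec (d + 1) (\<lambda>_. 1)"
proof -
  have "\<one>\<^bsub>idem_algebra TYPE('a) d\<^esub> = finsum (idem_algebra TYPE('a) d) (idem_vec d) {..d}"
    unfolding finsum_idem_algebra_eq by (simp add: idem_algebra_def Let_def)
  \<comment> \<open>The plain sum of the unit vectors is the linear combination with all
    coefficients 1.\<close>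
  then show ?thesis
    using finsum_smult_idem_vec[of d "\<lambda>_. 1 :: 'a"] by (simp add: idem_algebra_simps)
qed

lemma idem_algebra_algebra: "algebra class_ring (idem_algebra TYPE('a::field) d)"
proof -
  let ?C = "idem_algebra TYPE('a) d"
  interpret vectorspace class_ring ?C by (rule idem_algebra_vectorspace)
  have "comm_monoid ?C"
    by (rule comm_monoidI) (auto simp: idem_algebra_simps idem_algebra_mult_eq idem_algebra_one)
  then have "cring ?C"
    by (intro cringI M.abelian_group_axioms)
      (auto simp: idem_algebra_simps idem_algebra_mult_eq distrib_right)
  then show ?thesis
    by (intro algebra.intro module_axioms algebra_axioms.intro)
      (auto simp: idem_algebra_simps idem_algebra_mult_eq)
qed

lemma primitive_idempotents_idem_vec:
  "primitive_idempotents d (idem_algebra TYPE('a::field) d) (idem_vec d)"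
  unfolding primitive_idempotents_def
proof (intro conjI allI impI)
  show "basis_family d (idem_algebra TYPE('a) d) (idem_vec d)"
    by (rule basis_family_cols[of "1\<^sub>m (d + 1)" _ "1\<^sub>m (d + 1)"]) (simp_all add: col_one_idem_vec)
  show "\<one>\<^bsub>idem_algebra TYPE('a) d\<^esub> = finsum (idem_algebra TYPE('a) d) (idem_vec d) {..d}"
    unfolding finsum_idem_algebra_eq by (simp add: idem_algebra_def Let_def)
qed (rule idem_algebra_mult)

text \<open>A combination of the idempotents is the vector of its coefficients, so any candidate
  \<open>M\<close> has \<open>x j\<close> as column \<open>j\<close>. This gives the uniqueness
  demanded by \<open>THE\<close>.\<close>

lemma transition_matrix_idem_vec:
  fixes P :: "'a::field mat"
  assumes P: "P \<in> carrier_mat (d + 1) (d + 1)" and x: "\<And>j. j \<le> d \<Longrightarrow> x j = col P j"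
  shows "transition_matrix d (idem_algebra TYPE('a) d) (idem_vec d) x = P"
  unfolding transition_matrix_def finsum_smult_idem_vec
proof (rule the_equality)
  show "P \<in> carrier_mat (d + 1) (d + 1) \<and> (\<forall>j\<le>d. x j = vec (d + 1) (\<lambda>i. P $$ (i, j)))"
    using P x by (auto simp: col_def)
  fix M assume M: "M \<in> carrier_mat (d + 1) (d + 1) \<and> (\<forall>j\<le>d. x j = vec (d + 1) (\<lambda>i. M $$ (i, j)))"
  show "M = P"
  proof
    fix i j assume "i < dim_row P" "j < dim_col P"
    then have ij: "i < d + 1" "j \<le> d" using P by auto
    then have "vec (d + 1) (\<lambda>i. M $$ (i, j)) = col P j" using M x by metis
    then have "vec (d + 1) (\<lambda>i. M $$ (i, j)) $ i = col P j $ i" by simp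
    then show "M $$ (i, j) = P $$ (i, j)" using ij P by simp
  qed (use P M in auto)
qed

section \<open>Coordinate homomorphisms and intersection numbers\<close>

lemma algebra_hom_to_field_coordinate:
  assumes "i \<le> d"
  shows "algebra_hom_to_field (idem_algebra TYPE('a::field) d) (\<lambda>v. v $ i)"
  unfolding algebra_hom_to_field_def
proof
  show "(\<lambda>v. v $ i) \<in> Ring.ring_hom (idem_algebra TYPE('a) d) class_ring"
    using assms
    by (intro ring_hom_memI) (auto simp: idem_algebra_simps idem_algebra_mult_eq idem_algebra_one)
qed (use assms in \<open>auto simp: idem_algebra_simps\<close>)

text \<open>The product of \<open>x i\<close> and \<open>x j\<close> is the entrywise product
  \<open>w\<close> of columns \<open>i\<close> and \<open>j\<close> of \<open>P\<close>. Its
  coordinates with respect to \<open>x\<close> are the entries of \<open>Q *\<^sub>v w\<close>,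
  which are the stated sums.\<close>

lemma intersection_numbers_cols:
  fixes P Q :: "'a::field mat"
  assumes P: "P \<in> carrier_mat (d + 1) (d + 1)" and Q: "Q \<in> carrier_mat (d + 1) (d + 1)"
    and PQ: "P * Q = 1\<^sub>m (d + 1)" and x: "\<And>j. j \<le> d \<Longrightarrow> x j = col P j"
  shows "intersection_numbers d (idem_algebra TYPE('a) d) x
    (\<lambda>i j h. \<Sum>r\<le>d. Q $$ (h, r) * P $$ (r, i) * P $$ (r, j))"
  unfolding intersection_numbers_def
proof (intro allI impI)
  fix i j assume ij: "i \<le> d" "j \<le> d"
  let ?w = "vec (d + 1) (\<lambda>r. P $$ (r, i) * P $$ (r, j))"
  have w: "vec (d + 1) (\<lambda>h. \<Sum>r\<le>d. Q $$ (h, r) * P $$ (r, i) * P $$ (r, j)) = Q *\<^sub>v ?w"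
    using Q by (intro eq_vecI)
      (auto simp: scalar_prod_def atLeast0LessThan lessThan_Suc_atMost mult.assoc simp del: sum.atMost_Suc)
  have "P *\<^sub>v (Q *\<^sub>v ?w) = ?w" by (rule mult_mat_vec_cancel[OF P Q PQ]) simp
  moreover have "x i \<otimes>\<^bsub>idem_algebra TYPE('a) d\<^esub> x j = ?w"
    using P x ij by (auto simp: idem_algebra_mult_eq)
  moreover have "finsum (idem_algebra TYPE('a) d)
      (\<lambda>h. (\<Sum>r\<le>d. Q $$ (h, r) * P $$ (r, i) * P $$ (r, j))
        \<odot>\<^bsub>idem_algebra TYPE('a) d\<^esub> x h) {..d} = P *\<^sub>v (Q *\<^sub>v ?w)"
    unfolding w[symmetric] by (rule finsum_smult_cols[OF P x])
  ultimately show "x i \<otimes>\<^bsub>idem_algebra TYPE('a) d\<^esub> x j = finsum (idem_algebra TYPE('a) d)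
      (\<lambda>h. (\<Sum>r\<le>d. Q $$ (h, r) * P $$ (r, i) * P $$ (r, j))
        \<odot>\<^bsub>idem_algebra TYPE('a) d\<^esub> x h) {..d}"
    by metis
qed

section \<open>Almost orthogonality and the valencies\<close>

lemma almost_orthogonal_normalized_sum:
  fixes P :: "'a::field mat"
  assumes norm: "normalized d P" and ao: "almost_orthogonal d P" and ij: "i \<le> d" "j \<le> d"
  shows "(\<Sum>r\<le>d. mat_inv P $$ (0, r) * P $$ (r, i) * P $$ (r, j)) =
    (if i = j then P $$ (0, i) else 0)"
proof -
  define Q where "Q = mat_inv P"
  have P: "P \<in> carrier_mat (d + 1) (d + 1)" and inv: "invertible_mat P"
    using ao by (auto simp: almost_orthogonal_def)
  have Q: "Q \<in> carrier_mat (d + 1) (d + 1)" and QP: "Q * P = 1\<^sub>m (d + 1)"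
    using mat_inv_inverse[OF P inv] by (auto simp: Q_def)
  have P0: "P $$ (r, 0) = 1" if "r \<le> d" for r using norm that by (simp add: normalized_def)
  have Q0: "Q $$ (r, 0) = Q $$ (0, 0)" "Q $$ (r, 0) \<noteq> 0" if "r \<le> d" for r
    using norm that le0 unfolding normalized_def solid_def Q_def by blast+
  obtain H K where HK: "H \<in> carrier_mat (d + 1) (d + 1)" "K \<in> carrier_mat (d + 1) (d + 1)"
    "diagonal_mat H" "diagonal_mat K" "Q = H * transpose_mat P * K"
    using ao unfolding almost_orthogonal_def diagonally_equivalent_def Q_def by blast
  define h k where "h r = H $$ (r, r)" and "k r = K $$ (r, r)" for r
  have Q_eq: "Q $$ (r, s) = h r * P $$ (s, r) * k s" if "r \<le> d" "s \<le> d" for r s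
  proof -
    have "Q $$ (r, s) = H $$ (r, r) * transpose_mat P $$ (r, s) * K $$ (s, s)"
      unfolding HK(5) by (rule index_mat_mult_diagonal) (use HK(1-4) P that in auto)
    then show ?thesis using P that by (simp add: h_def k_def)
  qed
  \<comment> \<open>Solidity suffices: \<open>h r\<close> and \<open>k 0\<close> are factors of the
    nonzero entry \<open>Q $$ (r, 0)\<close>.\<close>
  have nz: "h r \<noteq> 0" "k 0 \<noteq> 0" if "r \<le> d" for r
    using Q0(2)[OF that] Q_eq[OF that, of 0] by auto
  \<comment> \<open>The entries \<open>(i, 0)\<close> and \<open>(0, 0)\<close> of \<open>Q\<close>
    agree by normalization, and \<open>P $$ (0, 0) = 1\<close>.\<close>
  have "h i * P $$ (0, i) * k 0 = h 0 * k 0"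
    using Q0(1)[OF ij(1)] Q_eq[of i 0] Q_eq[of 0 0] P0[of 0] ij by simp
  then have Pi: "h i * P $$ (0, i) = h 0" using nz[OF ij(1)] by simp
  \<comment> \<open>Replacing \<open>h 0\<close> by \<open>h i * P $$ (0, i)\<close> trades row 0 of
    \<open>Q\<close> for row \<open>i\<close>, so that the sum becomes a multiple of an entry of
    \<open>Q * P\<close>.\<close>
  have "Q $$ (0, r) * P $$ (r, i) = P $$ (0, i) * Q $$ (i, r)" if "r \<le> d" for r
    using Q_eq[of 0 r] Q_eq[of i r] P0[OF that] that ij Pi[symmetric] by simp
  then have "(\<Sum>r\<le>d. Q $$ (0, r) * P $$ (r, i) * P $$ (r, j)) =
      (\<Sum>r\<le>d. P $$ (0, i) * Q $$ (i, r) * P $$ (r, j))"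
    by (intro sum.cong) auto
  also have "\<dots> = P $$ (0, i) * (\<Sum>r\<le>d. Q $$ (i, r) * P $$ (r, j))"
    by (simp add: sum_distrib_left mult.assoc)
  also have "(\<Sum>r\<le>d. Q $$ (i, r) * P $$ (r, j)) = (Q * P) $$ (i, j)"
    using P Q ij by (simp add: scalar_prod_def atLeast0LessThan lessThan_Suc_atMost del: sum.atMost_Suc)
  finally show ?thesis using QP ij by (simp add: Q_def)
qed

section \<open>Assembly of the character system\<close>

theorem lemma11p3:
  fixes P :: "'a::field mat" and d :: nat
  assumes "P \<in> carrier_mat (d + 1) (d + 1)"
    and "invertible_mat P"
    and "solid d P"
    and "normalized d P"
    and "almost_orthogonal d P"
  shows "character_system d (Psi_of d P) \<and> eigenmatrix d (Psi_of d P) = P"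
proof -
  define C where "C = idem_algebra TYPE('a) d"
  define x where "x j = finsum C (\<lambda>i. P $$ (i, j) \<odot>\<^bsub>C\<^esub> idem_vec d i) {..d}" for j
  have Psi: "Psi_of d P = (C, x, idem_vec d)"
    by (simp add: Psi_of_def Let_def C_def x_def [abs_def])
  note P = assms(1)
  note Q = mat_inv_inverse[OF assms(1,2)]
  have x: "x j = col P j" if "j \<le> d" for j
    using P that by (simp add: x_def C_def finsum_smult_idem_vec col_def)
  \<comment> \<open>Normalization makes column 0 of \<open>P\<close> the all-ones vector, which is
    the unit.\<close>
  have x0: "x 0 = \<one>\<^bsub>C\<^esub>"
    unfolding x[OF le0] C_def idem_algebra_one
    using P assms(4) by (intro eq_vecI) (auto simp: normalized_def)
  \<comment> \<open>The valencies are row 0 of \<open>P\<close>, nonzero by solidity; the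
    intersection numbers with upper index 0 use row 0 of \<open>mat_inv P\<close>.\<close>
  have val: "valencies d C x (\<lambda>i. P $$ (0, i))"
    unfolding valencies_def
  proof (intro conjI exI)
    show "\<forall>i\<le>d. P $$ (0, i) \<noteq> 0" using assms(3) by (simp add: solid_def)
    show "intersection_numbers d C x
        (\<lambda>i j h. \<Sum>r\<le>d. mat_inv P $$ (h, r) * P $$ (r, i) * P $$ (r, j))"
      unfolding C_def by (rule intersection_numbers_cols[OF P Q(1,2) x])
    show "\<forall>i\<le>d. \<forall>j\<le>d. (\<Sum>r\<le>d. mat_inv P $$ (0, r) * P $$ (r, i) * P $$ (r, j)) =
        (if i = j then P $$ (0, i) else 0)"
      using almost_orthogonal_normalized_sum[OF assms(4,5)] by blast
  qed
  have hom: "character_hom d C x (\<lambda>v. v $ 0)"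
    unfolding character_hom_def
  proof (intro conjI exI)
    show "algebra_hom_to_field C (\<lambda>v. v $ 0)"
      unfolding C_def by (rule algebra_hom_to_field_coordinate) simp
    show "\<forall>i\<le>d. x i $ 0 = P $$ (0, i)" using P x by simp
  qed (rule val)
  have "character_algebra d C x"
    unfolding character_algebra_def
    using idem_algebra_algebra basis_family_cols[OF P Q x] x0 hom by (auto simp: C_def)
  \<comment> \<open>Coordinate 0 of the unit vector \<open>idem_vec d 0\<close> is 1, hence
    nonzero.\<close>
  moreover have "trivial_idempotent d C x (idem_vec d 0)"
    unfolding trivial_idempotent_def using hom by (auto simp: idem_vec_def)
  moreover have "primitive_idempotents d C (idem_vec d)"
    unfolding C_def by (rule primitive_idempotents_idem_vec)
  moreover have "transition_matrix d C (idem_vec d) x = P"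
    unfolding C_def by (rule transition_matrix_idem_vec[OF P x])
  ultimately show ?thesis
    by (auto simp: Psi character_system_def semisimple_def eigenmatrix_def)
qed

end
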